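(* Assume $0<\gamma<1/L_f$, or $\mu_f>0$ and $\gamma>1/\mu_f$. Then the Douglas-Rachford envelope $F^{\mathrm{DR}}_\gamma$ is continuously differentiable on $\mathbb{R}^n$ with $$\nabla F^{\mathrm{DR}}_\gamma(x)=\gamma^{-1}\bigl(2\nabla P_\gamma(x)-I\bigr)Z_\gamma(x)\quad\text{for all }x\in\mathbb{R}^n,$$ the matrix $2\nabla P_\gamma(x)-I$ is nonsingular for every $x\in\mathbb{R}^n$, and the set of stationary points $\{x:\nabla F^{\mathrm{DR}}_\gamma(x)=0\}$ is equal to $\tilde X$. Moreover, for any $x^0\in\mathbb{R}^n$ and stepsizes $\lambda_k$, the iterates $x^k$ of Douglas-Rachford splitting $$y^k=\mathrm{prox}_{\gamma f}(x^k),\qquad z^k=\mathrm{prox}_{\gamma g}(2y^k-x^k),\qquad x^{k+1}=x^k+\lambda_k(z^k-y^k)$$ satisfy, for every $k\ge 0$, $$x^{k+1}=x^k-\lambda_kD^k\nabla F^{\mathrm{DR}}_\gamma(x^k),\qquad D^k=\gamma\bigl(2\nabla P_\gamma(x^k)-I\bigr)^{-1}.$$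
   Context: Let $f:\mathbb{R}^n\to\mathbb{R}$ be convex and twice continuously differentiable with $L_f$-Lipschitz continuous gradient, and let $\mu_f\ge 0$ be such that $f-\tfrac{\mu_f}{2}\|\cdot\|^2$ is convex ($\mu_f=0$ is allowed). Let $g:\mathbb{R}^n\to\mathbb{R}\cup\{+\infty\}$ be proper, closed and convex. Put $F=f+g$ and assume that the set of minimizers of $F$ is nonempty. For $\gamma>0$ and a proper closed convex function $h$, $\mathrm{prox}_{\gamma h}(x)=\arg\min_z\{h(z)+\tfrac{1}{2\gamma}\|z-x\|^2\}$ and $h^\gamma(x)=\inf_z\{h(z)+\tfrac{1}{2\gamma}\|z-x\|^2\}$ (the Moreau envelope). Define $P_\gamma(x)=\mathrm{prox}_{\gamma f}(x)$ (a differentiable map with Jacobian $\nabla P_\gamma(x)$), $G_\gamma(x)=\mathrm{prox}_{\gamma g}(2P_\gamma(x)-x)$, $Z_\gamma(x)=P_\gamma(x)-G_\gamma(x)$, and $\tilde X=\{x\in\mathbb{R}^n: Z_\gamma(x)=0\}$. The Douglas-Rachford envelope is $$F^{\mathrm{DR}}_\gamma(x)=f^\gamma(x)-\gamma\|\nabla f^\gamma(x)\|^2+g^\gamma\bigl(x-2\gamma\nabla f^\gamma(x)\bigr).$$ Convention: $1/L_f=+\infty$ if $L_f=0$. *)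

theory Defs
  imports "HOL-Analysis.Analysis"
begin

definition grad :: "('a::real_inner \<Rightarrow> real) \<Rightarrow> 'a \<Rightarrow> 'a"
  where "grad f x = (THE D. GDERIV f x :> D)"

definition C1_fun :: "('a::real_inner \<Rightarrow> real) \<Rightarrow> bool"
  where "C1_fun f \<longleftrightarrow> (\<forall>x. f differentiable (at x)) \<and> continuous_on UNIV (grad f)"

text \<open>The Jacobian of the gradient is the Hessian.\<close>
definition C2_fun :: "(real^'n \<Rightarrow> real) \<Rightarrow> bool"
  where "C2_fun f \<longleftrightarrow>
    (\<forall>x. f differentiable (at x)) \<and>
    (\<forall>x. grad f differentiable (at x)) \<and>
    continuous_on UNIV (\<lambda>x. jacobian (grad f) (at x))"

text \<open>Convexity and closedness of an extended-real-valued function are those of its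
  epigraph, a subset of the domain times the (finite) reals.\<close>
definition epi :: "('a \<Rightarrow> ereal) \<Rightarrow> ('a \<times> real) set"
  where "epi h = {(x, t). h x \<le> ereal t}"

definition proper_closed_convex :: "('a::real_normed_vector \<Rightarrow> ereal) \<Rightarrow> bool"
  where "proper_closed_convex h \<longleftrightarrow>
    (\<forall>x. h x \<noteq> -\<infinity>) \<and> (\<exists>x. h x \<noteq> \<infinity>) \<and> closed (epi h) \<and> convex (epi h)"

definition prox :: "real \<Rightarrow> ('a::real_normed_vector \<Rightarrow> ereal) \<Rightarrow> 'a \<Rightarrow> 'a"
  where "prox \<gamma> h x = arg_min (\<lambda>z. h z + ereal (1 / (2 * \<gamma>) * (norm (z - x))\<^sup>2)) (\<lambda>_. True)"

definition moreau_env :: "real \<Rightarrow> ('a::real_normed_vector \<Rightarrow> ereal) \<Rightarrow> 'a \<Rightarrow> ereal"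
  where "moreau_env \<gamma> h x = (INF z. h z + ereal (1 / (2 * \<gamma>) * (norm (z - x))\<^sup>2))"

definition DR_P :: "real \<Rightarrow> ('a::real_normed_vector \<Rightarrow> real) \<Rightarrow> 'a \<Rightarrow> 'a"
  where "DR_P \<gamma> f x = prox \<gamma> (\<lambda>z. ereal (f z)) x"

definition DR_G :: "real \<Rightarrow> ('a::real_normed_vector \<Rightarrow> real) \<Rightarrow> ('a \<Rightarrow> ereal) \<Rightarrow> 'a \<Rightarrow> 'a"
  where "DR_G \<gamma> f g x = prox \<gamma> g (2 *\<^sub>R DR_P \<gamma> f x - x)"

definition DR_Z :: "real \<Rightarrow> ('a::real_normed_vector \<Rightarrow> real) \<Rightarrow> ('a \<Rightarrow> ereal) \<Rightarrow> 'a \<Rightarrow> 'a"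
  where "DR_Z \<gamma> f g x = DR_P \<gamma> f x - DR_G \<gamma> f g x"

text \<open>The envelope is kept extended-real-valued, so that its finiteness is a claim to be proved
  and not an artefact of the totality of \<^const>\<open>real_of_ereal\<close>.\<close>
definition DR_env :: "real \<Rightarrow> ('a::real_inner \<Rightarrow> real) \<Rightarrow> ('a \<Rightarrow> ereal) \<Rightarrow> 'a \<Rightarrow> ereal"
  where "DR_env \<gamma> f g x =
    (let f\<gamma> = moreau_env \<gamma> (\<lambda>z. ereal (f z));
         d = grad (\<lambda>w. real_of_ereal (f\<gamma> w)) x
     in f\<gamma> x - ereal (\<gamma> * (norm d)\<^sup>2) + moreau_env \<gamma> g (x - (2 * \<gamma>) *\<^sub>R d))"

definition DR_env_real :: "real \<Rightarrow> ('a::real_inner \<Rightarrow> real) \<Rightarrow> ('a \<Rightarrow> ereal) \<Rightarrow> 'a \<Rightarrow> real"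
  where "DR_env_real \<gamma> f g x = real_of_ereal (DR_env \<gamma> f g x)"

definition reflected_jacobian :: "real \<Rightarrow> (real^'n \<Rightarrow> real) \<Rightarrow> real^'n \<Rightarrow> real^'n^'n"
  where "reflected_jacobian \<gamma> f x = 2 *\<^sub>R jacobian (DR_P \<gamma> f) (at x) - mat 1"

definition DR_splitting ::
  "real \<Rightarrow> ('a::real_normed_vector \<Rightarrow> real) \<Rightarrow> ('a \<Rightarrow> ereal) \<Rightarrow> (nat \<Rightarrow> real) \<Rightarrow>
   (nat \<Rightarrow> 'a) \<Rightarrow> (nat \<Rightarrow> 'a) \<Rightarrow> (nat \<Rightarrow> 'a) \<Rightarrow> bool"
  where "DR_splitting \<gamma> f g lam x y z \<longleftrightarrow>
    (\<forall>k. y k = prox \<gamma> (\<lambda>w. ereal (f w)) (x k) \<and>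
         z k = prox \<gamma> g (2 *\<^sub>R y k - x k) \<and>
         x (Suc k) = x k + lam k *\<^sub>R (z k - y k))"

end

theory Submission
  imports Defs
begin

text \<open>
  Write \<open>H\<close> for the Hessian of \<open>f\<close> at \<open>p = P x\<close>.  The Moreau envelope of a proper closed convex \<open>h\<close>
  is differentiable with gradient \<open>(x - prox h x) / \<gamma>\<close> (\<open>moreau_env_gradient\<close>), so the
  Douglas-Rachford envelope is really
  \<open>F x = f\<^sup>\<gamma> x - |x - P x|\<^sup>2 / \<gamma> + g\<^sup>\<gamma> (2 P x - x)\<close>.  The map \<open>P\<close> is the inverse of
  \<open>I + \<gamma> \<nabla>f\<close>, whose derivative \<open>I + \<gamma> H\<close> does not shrink any vector because \<open>H\<close> is
  positive semidefinite.  As \<open>P\<close> is nonexpansive, hence continuous, the rule for derivatives of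
  inverse maps gives the Jacobian \<open>J = (I + \<gamma> H)\<^sup>-\<^sup>1\<close> (\<open>prox_has_derivative\<close>), and the bound on the
  inverse makes \<open>J Z\<close> continuous (\<open>continuous_on_linear_solution\<close>).

  The chain rule then gives \<open>DF(x) h = \<langle>(2 J - I) h, Z x\<rangle> / \<gamma>\<close>: the terms in \<open>x - P x\<close> cancel.
  To read off the gradient as \<open>(2 J - I) Z x / \<gamma>\<close>, without a transpose, one needs \<open>J\<close>, that is
  \<open>H\<close>, to be symmetric (\<open>second_derivative_symmetric\<close>).

  The matrix \<open>2 J - I = (I - \<gamma> H)(I + \<gamma> H)\<^sup>-\<^sup>1\<close> is singular only if \<open>1\<close> is an eigenvalue of
  \<open>\<gamma> H\<close> (\<open>reflected_inverse_invertible\<close>).  The eigenvalues of \<open>H\<close> lie between \<open>\<mu>\<close> and \<open>L\<close>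
  (\<open>strongly_convex_hessian_lower\<close>, \<open>lipschitz_derivative_bound\<close>), and the two ranges of \<open>\<gamma>\<close> put
  all eigenvalues of \<open>\<gamma> H\<close> strictly below or strictly above \<open>1\<close>.  The stationary points and the
  form of the iteration follow by cancelling this invertible matrix.
\<close>

section \<open>Proximal maps and Moreau envelopes of extended-real convex functions\<close>

text \<open>
  Separating a point below the graph from the epigraph gives an affine minorant of \<open>h\<close>, so the
  quadratic term dominates and the objective has compact sublevel sets.  Minimizing over the epigraph
  in the product space, where the objective is a continuous real function, makes closedness of
  the epigraph do the work of lower semicontinuity.
\<close>

lemma prox_minimizer_exists:
  fixes h :: "'a::euclidean_space \<Rightarrow> ereal"
  assumes h: "proper_closed_convex h" and \<gamma>: "\<gamma> > 0"
  shows "\<exists>p. is_arg_min (\<lambda>z. h z + ereal (1 / (2 * \<gamma>) * (norm (z - x))\<^sup>2)) (\<lambda>_. True) p"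
proof -
  define q where "q z = 1 / (2 * \<gamma>) * (norm (z - x))\<^sup>2" for z
  obtain z0 where z0: "h z0 \<noteq> \<infinity>" using h unfolding proper_closed_convex_def by blast
  have ninf: "h z \<noteq> -\<infinity>" for z using h unfolding proper_closed_convex_def by blast
  obtain r0 where r0: "h z0 = ereal r0" using z0 ninf[of z0] by (cases "h z0") auto
  have cl: "closed (epi h)" and cv: "convex (epi h)" using h unfolding proper_closed_convex_def by auto
  have "(z0, r0 - 1) \<notin> epi h" by (simp add: epi_def r0)
  then obtain w c where w: "inner w (z0, r0 - 1) < c" "\<And>y. y \<in> epi h \<Longrightarrow> inner w y > c"
    using separating_hyperplane_closed_point[OF cv cl] by blast
  obtain a b where ab: "w = (a, b)" by (cases w)
  have low: "c < inner a z + b * t" if "h z \<le> ereal t" for z t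
    using w(2)[of "(z, t)"] that by (simp add: epi_def ab)
  \<comment> \<open>The separating hyperplane is not vertical: compare the two points over \<open>z0\<close>.\<close>
  have b: "b > 0" using low[of z0 r0] w(1) by (simp add: ab r0 algebra_simps)
  define m where "m = r0 + q z0"
  define \<phi> where "\<phi> y = snd y + q (fst y)" for y :: "'a \<times> real"
  define S where "S = {y \<in> epi h. \<phi> y \<le> m}"
  have cont: "continuous_on T \<phi>" for T
    unfolding \<phi>_def q_def by (intro continuous_intros)
  have clS: "closed S"
  proof -
    have "S = epi h \<inter> {y. \<phi> y \<le> m}" by (auto simp: S_def)
    then show ?thesis using cl closed_Collect_le[OF cont continuous_on_const] by auto
  qed
  define K where "K = norm a / b"
  define C where "C = m - c / b + inner a x / b"
  \<comment> \<open>Beyond this radius the quadratic exceeds the linear bound \<open>C + K * norm (z - x)\<close>.\<close>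
  define \<rho> where "\<rho> = 1 + 2 * \<gamma> * (K + \<bar>C\<bar>)"
  have K: "K \<ge> 0" using b by (simp add: K_def)
  have bnd: "norm (z - x) \<le> \<rho> \<and> - \<bar>c / b - inner a x / b\<bar> - K * \<rho> \<le> t \<and> t \<le> m" if "(z, t) \<in> S" for z t
  proof -
    have ht: "h z \<le> ereal t" and le: "t + q z \<le> m" using that by (auto simp: S_def epi_def \<phi>_def)
    have "c / b < inner a z / b + t" using low[OF ht] b by (simp add: field_simps)
    moreover have "inner a z / b = inner a (z - x) / b + inner a x / b"
      by (simp add: inner_diff_right diff_divide_distrib)
    moreover have "inner a (z - x) / b \<le> K * norm (z - x)"
      using Cauchy_Schwarz_ineq2[of a "z - x"] b by (auto simp: K_def field_simps)
    ultimately have tlow: "t > c / b - inner a x / b - K * norm (z - x)" by linarith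
    then have qle: "q z \<le> C + K * norm (z - x)" using le by (simp add: C_def)
    have n: "norm (z - x) \<le> \<rho>"
    proof (rule ccontr)
      assume "\<not> ?thesis"
      then have big: "norm (z - x) > \<rho>" by simp
      have "\<rho> \<ge> 1" using \<gamma> K by (simp add: \<rho>_def)
      then have one: "norm (z - x) > 1" using big by linarith
      have "norm (z - x) > 2 * \<gamma> * (K + \<bar>C\<bar>)" using big by (simp add: \<rho>_def)
      then have "norm (z - x) * norm (z - x) > 2 * \<gamma> * (K + \<bar>C\<bar>) * norm (z - x)"
        using one by (intro mult_strict_right_mono) auto
      then have "q z > (K + \<bar>C\<bar>) * norm (z - x)"
        using \<gamma> by (simp add: q_def power2_eq_square field_simps)
      moreover have "\<bar>C\<bar> * norm (z - x) \<ge> \<bar>C\<bar>" using one by (simp add: mult_le_cancel_left1)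
      ultimately show False using qle by (simp add: algebra_simps)
    qed
    have "K * norm (z - x) \<le> K * \<rho>" using n K by (simp add: mult_left_mono)
    moreover have "q z \<ge> 0" using \<gamma> by (simp add: q_def)
    ultimately show ?thesis using n tlow le by linarith
  qed
  have "S \<subseteq> cball x \<rho> \<times> {- \<bar>c / b - inner a x / b\<bar> - K * \<rho> .. m}"
    using bnd by (auto simp: dist_norm norm_minus_commute)
  then have "bounded S" by (rule bounded_subset[rotated]) (auto intro: bounded_Times)
  then have "compact S" using clS compact_eq_bounded_closed by blast
  moreover have z0S: "(z0, r0) \<in> S" by (simp add: S_def epi_def r0 \<phi>_def m_def)
  ultimately have "\<exists>y\<in>S. \<forall>y'\<in>S. \<phi> y \<le> \<phi> y'"
    by (intro continuous_attains_inf cont) auto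
  then obtain y where y: "y \<in> S" "\<And>y'. y' \<in> S \<Longrightarrow> \<phi> y \<le> \<phi> y'" by blast
  obtain p r where pr: "y = (p, r)" by (cases y)
  have hp: "h p \<le> ereal r" using y(1) by (auto simp: pr S_def epi_def)
  have "h p + ereal (q p) \<le> h z + ereal (q z)" for z
  proof (cases "h z")
    case (real t)
    have "r + q p \<le> t + q z"
    proof (cases "t + q z \<le> m")
      case True
      then show ?thesis using y(2)[of "(z, t)"] by (simp add: S_def epi_def real \<phi>_def pr)
    next
      case False
      then show ?thesis using y(1) by (simp add: S_def \<phi>_def pr)
    qed
    moreover have "h p + ereal (q p) \<le> ereal r + ereal (q p)" using hp by (rule add_right_mono)
    ultimately show ?thesis using real by (metis ereal_less_eq(3) order_trans plus_ereal.simps(1))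
  qed (use ninf in auto)
  then show ?thesis unfolding is_arg_min_def q_def by (auto simp: not_less)
qed

lemma prox_le:
  fixes h :: "'a::euclidean_space \<Rightarrow> ereal"
  assumes "proper_closed_convex h" "\<gamma> > 0"
  shows "h (prox \<gamma> h x) + ereal (1 / (2 * \<gamma>) * (norm (prox \<gamma> h x - x))\<^sup>2)
    \<le> h z + ereal (1 / (2 * \<gamma>) * (norm (z - x))\<^sup>2)"
proof -
  have "is_arg_min (\<lambda>z. h z + ereal (1 / (2 * \<gamma>) * (norm (z - x))\<^sup>2)) (\<lambda>_. True) (prox \<gamma> h x)"
    unfolding prox_def arg_min_def by (rule someI_ex) (rule prox_minimizer_exists[OF assms])
  then show ?thesis unfolding is_arg_min_def by (auto simp: not_less)
qed

lemma prox_finite: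
  fixes h :: "'a::euclidean_space \<Rightarrow> ereal"
  assumes "proper_closed_convex h" "\<gamma> > 0"
  shows "\<bar>h (prox \<gamma> h x)\<bar> \<noteq> \<infinity>"
proof -
  obtain z0 where "h z0 \<noteq> \<infinity>" using assms(1) unfolding proper_closed_convex_def by blast
  moreover have "h (prox \<gamma> h x) \<noteq> -\<infinity>" using assms(1) unfolding proper_closed_convex_def by blast
  ultimately show ?thesis using prox_le[OF assms, of x z0] by auto
qed

lemma moreau_env_eq:
  fixes h :: "'a::euclidean_space \<Rightarrow> ereal"
  assumes "proper_closed_convex h" "\<gamma> > 0"
  shows "moreau_env \<gamma> h x = ereal (real_of_ereal (h (prox \<gamma> h x)) +
    1 / (2 * \<gamma>) * (norm (prox \<gamma> h x - x))\<^sup>2)"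
proof -
  have "moreau_env \<gamma> h x = h (prox \<gamma> h x) + ereal (1 / (2 * \<gamma>) * (norm (prox \<gamma> h x - x))\<^sup>2)"
    unfolding moreau_env_def using prox_le[OF assms, of x]
    by (intro antisym INF_greatest INF_lower) auto
  also have "h (prox \<gamma> h x) = ereal (real_of_ereal (h (prox \<gamma> h x)))"
    using prox_finite[OF assms] by (simp add: ereal_real)
  finally show ?thesis by simp
qed

text \<open>
  \<open>(x - p) / \<gamma>\<close> is a subgradient of \<open>h\<close> at \<open>p = prox x\<close>: compare \<open>p\<close> with the points
  \<open>p + s (z - p)\<close>, divide by \<open>s\<close> and let \<open>s\<close> tend to \<open>0\<close>.  A real bound \<open>t\<close> on \<open>h z\<close> keeps the
  inequality within the reals also where \<open>h\<close> is infinite.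
\<close>

lemma prox_variational:
  fixes h :: "'a::euclidean_space \<Rightarrow> ereal"
  assumes "proper_closed_convex h" "\<gamma> > 0"
    and t: "h z \<le> ereal t"
  shows "real_of_ereal (h (prox \<gamma> h x)) + inner (x - prox \<gamma> h x) (z - prox \<gamma> h x) / \<gamma> \<le> t"
proof -
  define p where "p = prox \<gamma> h x"
  define r where "r = real_of_ereal (h p)"
  have r: "h p = ereal r" using prox_finite[OF assms(1,2)] by (simp add: r_def p_def ereal_real)
  have cv: "convex (epi h)" using assms(1) unfolding proper_closed_convex_def by auto
  define B where "B = (norm (z - p))\<^sup>2 / (2 * \<gamma>)"
  have ineq: "inner (x - p) (z - p) / \<gamma> \<le> t - r + s * B" if s: "0 < s" "s \<le> 1" for s
  proof -
    have "(1 - s) *\<^sub>R (p, r) + s *\<^sub>R (z, t) \<in> epi h"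
      using s t by (intro convexD[OF cv]) (auto simp: epi_def r)
    then have "h (p + s *\<^sub>R (z - p)) \<le> ereal (r + s * (t - r))"
      by (simp add: epi_def algebra_simps)
    then have "h (p + s *\<^sub>R (z - p)) + ereal (1 / (2 * \<gamma>) * (norm (p + s *\<^sub>R (z - p) - x))\<^sup>2)
        \<le> ereal (r + s * (t - r)) + ereal (1 / (2 * \<gamma>) * (norm (p + s *\<^sub>R (z - p) - x))\<^sup>2)"
      by (rule add_right_mono)
    from order_trans[OF prox_le[OF assms(1,2)] this]
    have "r + (norm (p - x))\<^sup>2 / (2 * \<gamma>)
        \<le> r + s * (t - r) + (norm (p + s *\<^sub>R (z - p) - x))\<^sup>2 / (2 * \<gamma>)"
      by (simp add: p_def[symmetric] r)
    moreover have "(norm (p + s *\<^sub>R (z - p) - x))\<^sup>2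
        = (norm (p - x))\<^sup>2 - 2 * s * inner (x - p) (z - p) + s\<^sup>2 * (norm (z - p))\<^sup>2"
      unfolding power2_norm_eq_inner
      by (simp add: inner_add_left inner_add_right inner_diff_left inner_diff_right inner_commute
          power2_eq_square algebra_simps)
    ultimately have "(norm (p - x))\<^sup>2 / (2 * \<gamma>)
        \<le> s * (t - r) + ((norm (p - x))\<^sup>2 - 2 * s * inner (x - p) (z - p) + s\<^sup>2 * (norm (z - p))\<^sup>2) / (2 * \<gamma>)"
      by simp
    also have "\<dots> = (norm (p - x))\<^sup>2 / (2 * \<gamma>) + s * (t - r) - s * (inner (x - p) (z - p) / \<gamma>) + s * (s * B)"
      unfolding B_def add_divide_distrib diff_divide_distrib using \<open>\<gamma> > 0\<close>
      by (simp add: power2_eq_square)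
    finally have "s * (inner (x - p) (z - p) / \<gamma>) \<le> s * (t - r + s * B)"
      by (simp add: distrib_left)
    then show ?thesis using s(1) by (rule mult_left_le_imp_le)
  qed
  have "((\<lambda>s. t - r + s * B) \<longlongrightarrow> t - r + 0 * B) (at_right 0)"
    by (intro tendsto_intros)
  moreover have "eventually (\<lambda>s. inner (x - p) (z - p) / \<gamma> \<le> t - r + s * B) (at_right 0)"
    unfolding eventually_at_right_field by (intro exI[of _ 1] conjI allI impI) (use ineq in auto)
  ultimately have "inner (x - p) (z - p) / \<gamma> \<le> t - r + 0 * B"
    by (intro tendsto_lowerbound[where F = "at_right 0"]) auto
  then show ?thesis by (simp add: p_def r_def)
qed

text \<open>
  Add the subgradient inequalities at the two proximal points; the values of \<open>h\<close> cancel.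
\<close>

lemma prox_firmly_nonexpansive:
  fixes h :: "'a::euclidean_space \<Rightarrow> ereal"
  assumes "proper_closed_convex h" "\<gamma> > 0"
  shows "(norm (prox \<gamma> h x - prox \<gamma> h y))\<^sup>2 \<le> inner (prox \<gamma> h x - prox \<gamma> h y) (x - y)"
proof -
  have fin: "h (prox \<gamma> h w) \<le> ereal (real_of_ereal (h (prox \<gamma> h w)))" for w
    using prox_finite[OF assms] by (simp add: ereal_real)
  have "inner (x - prox \<gamma> h x) (prox \<gamma> h y - prox \<gamma> h x) / \<gamma>
      + inner (y - prox \<gamma> h y) (prox \<gamma> h x - prox \<gamma> h y) / \<gamma> \<le> 0"
    using prox_variational[OF assms fin, of y x] prox_variational[OF assms fin, of x y] by linarith
  then have "inner (x - prox \<gamma> h x) (prox \<gamma> h y - prox \<gamma> h x)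
      + inner (y - prox \<gamma> h y) (prox \<gamma> h x - prox \<gamma> h y) \<le> 0"
    using \<open>\<gamma> > 0\<close> by (simp add: field_simps)
  then show ?thesis unfolding power2_norm_eq_inner
    by (simp add: inner_diff_left inner_diff_right inner_commute algebra_simps)
qed

lemma prox_nonexpansive:
  fixes h :: "'a::euclidean_space \<Rightarrow> ereal"
  assumes "proper_closed_convex h" "\<gamma> > 0"
  shows "norm (prox \<gamma> h x - prox \<gamma> h y) \<le> norm (x - y)"
proof -
  have "norm (prox \<gamma> h x - prox \<gamma> h y) * norm (prox \<gamma> h x - prox \<gamma> h y)
      \<le> norm (prox \<gamma> h x - prox \<gamma> h y) * norm (x - y)"
    using prox_firmly_nonexpansive[OF assms, of x y]
      norm_cauchy_schwarz[of "prox \<gamma> h x - prox \<gamma> h y" "x - y"]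
    by (simp add: power2_eq_square)
  then show ?thesis by (cases "prox \<gamma> h x = prox \<gamma> h y") auto
qed

lemma continuous_on_prox:
  fixes h :: "'a::euclidean_space \<Rightarrow> ereal"
  assumes "proper_closed_convex h" "\<gamma> > 0"
  shows "continuous_on UNIV (prox \<gamma> h)"
proof -
  have "1-lipschitz_on UNIV (prox \<gamma> h)"
    using prox_nonexpansive[OF assms] by (intro lipschitz_onI) (auto simp: dist_norm)
  then show ?thesis by (rule lipschitz_on_continuous_on)
qed

lemma has_derivative_quadratic_error:
  fixes f :: "'a::real_normed_vector \<Rightarrow> 'b::real_normed_vector"
  assumes "bounded_linear D" and "\<And>y. norm (f y - f x - D (y - x)) \<le> C * (norm (y - x))\<^sup>2"
  shows "(f has_derivative D) (at x)"
proof (rule has_derivativeI_sandwich[where e = 1 and H = "\<lambda>y. C * norm (y - x)"])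
  show "((\<lambda>y. C * norm (y - x)) \<longlongrightarrow> 0) (at x)"
    by (auto intro!: tendsto_eq_intros)
  show "norm (f y - f x - D (y - x)) / norm (y - x) \<le> C * norm (y - x)" if "y \<noteq> x" for y
    using assms(2)[of y] that by (simp add: divide_le_eq power2_eq_square)
qed (use assms in auto)

text \<open>
  Testing the infimum at \<open>v\<close> with the minimizer for \<open>u\<close> bounds the increment \<open>e v - e u\<close> from above
  by its linear part plus a quadratic error.  Exchanging \<open>u\<close> and \<open>v\<close>, and using that \<open>prox\<close> is
  Lipschitz, gives the same bound from below.
\<close>

lemma moreau_env_gradient:
  fixes h :: "'a::euclidean_space \<Rightarrow> ereal"
  assumes "proper_closed_convex h" "\<gamma> > 0"
  shows "GDERIV (\<lambda>w. real_of_ereal (moreau_env \<gamma> h w)) x :> (1 / \<gamma>) *\<^sub>R (x - prox \<gamma> h x)"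
proof -
  define P where "P = prox \<gamma> h"
  define e where "e w = real_of_ereal (moreau_env \<gamma> h w)" for w
  define D where "D w = (1 / \<gamma>) *\<^sub>R (w - P w)" for w
  have e: "e w = real_of_ereal (h (P w)) + 1 / (2 * \<gamma>) * (norm (P w - w))\<^sup>2" for w
    unfolding e_def P_def moreau_env_eq[OF assms] by simp
  have fin: "h (P w) = ereal (real_of_ereal (h (P w)))" for w
    unfolding P_def using prox_finite[OF assms] by (simp add: ereal_real)
  have up: "e v - e u \<le> inner (v - u) (D u) + (norm (v - u))\<^sup>2 / (2 * \<gamma>)" for u v
  proof -
    have "h (P v) + ereal (1 / (2 * \<gamma>) * (norm (P v - v))\<^sup>2)
        \<le> h (P u) + ereal (1 / (2 * \<gamma>) * (norm (P u - v))\<^sup>2)"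
      unfolding P_def by (rule prox_le[OF assms])
    then have "e v \<le> real_of_ereal (h (P u)) + 1 / (2 * \<gamma>) * (norm (P u - v))\<^sup>2"
      unfolding e by (subst (asm) (1 2) fin) simp
    then have "e v - e u \<le> 1 / (2 * \<gamma>) * ((norm (P u - v))\<^sup>2 - (norm (P u - u))\<^sup>2)"
      by (simp add: e right_diff_distrib)
    also have "(norm (P u - v))\<^sup>2 - (norm (P u - u))\<^sup>2
        = 2 * inner (v - u) (u - P u) + (norm (v - u))\<^sup>2"
      unfolding power2_norm_eq_inner
      by (simp add: inner_diff_left inner_diff_right inner_commute algebra_simps)
    finally show ?thesis unfolding D_def inner_scaleR_right using \<open>\<gamma> > 0\<close> by (simp add: field_simps)
  qed
  have low: "inner (v - u) (D u) - (norm (v - u))\<^sup>2 / (2 * \<gamma>) - 2 * (norm (v - u))\<^sup>2 / \<gamma> \<le> e v - e u" for u v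
  proof -
    have "D v - D u = (1 / \<gamma>) *\<^sub>R ((v - u) - (P v - P u))"
      by (simp add: D_def scaleR_diff_right)
    then have "norm (D v - D u) = norm ((v - u) - (P v - P u)) / \<gamma>"
      using \<open>\<gamma> > 0\<close> by simp
    also have "norm ((v - u) - (P v - P u)) \<le> 2 * norm (v - u)"
      using norm_triangle_ineq4[of "v - u" "P v - P u"] prox_nonexpansive[OF assms, of v u]
      by (simp add: P_def)
    finally have *: "norm (D v - D u) \<le> 2 * norm (v - u) / \<gamma>"
      using \<open>\<gamma> > 0\<close> by (simp add: divide_right_mono)
    have "\<bar>inner (v - u) (D v - D u)\<bar> \<le> norm (v - u) * norm (D v - D u)"
      by (rule Cauchy_Schwarz_ineq2)
    also have "\<dots> \<le> norm (v - u) * (2 * norm (v - u) / \<gamma>)"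
      by (rule mult_left_mono[OF *]) simp
    finally have "\<bar>inner (v - u) (D v - D u)\<bar> \<le> 2 * (norm (v - u))\<^sup>2 / \<gamma>"
      by (simp add: power2_eq_square mult_ac)
    moreover have "inner (u - v) (D v) = - inner (v - u) (D v - D u) - inner (v - u) (D u)"
      by (simp add: inner_diff_left inner_diff_right)
    ultimately show ?thesis using up[of u v] by (simp add: norm_minus_commute abs_le_iff)
  qed
  have "(e has_derivative (\<lambda>w. inner w (D x))) (at x)"
  proof (rule has_derivative_quadratic_error[where C = "1 / (2 * \<gamma>) + 2 / \<gamma>"])
    show "norm (e y - e x - inner (y - x) (D x)) \<le> (1 / (2 * \<gamma>) + 2 / \<gamma>) * (norm (y - x))\<^sup>2" for y
    proof -
      have "2 * (norm (y - x))\<^sup>2 / \<gamma> \<ge> 0" using \<open>\<gamma> > 0\<close> by simp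
      then show ?thesis using up[of y x] low[of y x] by (simp add: distrib_right abs_le_iff)
    qed
  qed (rule bounded_linear_inner_left)
  then show ?thesis unfolding gderiv_def D_def P_def e_def .
qed

section \<open>Second-order facts: symmetry and bounds of the Hessian\<close>

text \<open>
  The mean value theorem along \<open>u\<close> turns the second difference into an increment of the gradient,
  which differentiability at the single point \<open>x\<close> approximates by \<open>H\<close>.
\<close>

lemma second_difference:
  fixes f :: "'a::real_inner \<Rightarrow> real"
  assumes G: "\<And>z. GDERIV f z :> G z"
    and H: "(G has_derivative H) (at x)" and "e > 0"
  shows "\<exists>\<delta>>0. \<forall>t. 0 < t \<and> t < \<delta> \<longrightarrow>
    \<bar>f (x + t *\<^sub>R u + t *\<^sub>R v) - f (x + t *\<^sub>R u) - f (x + t *\<^sub>R v) + f x - t\<^sup>2 * inner u (H v)\<bar> \<le> e * t\<^sup>2"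
proof -
  interpret H: bounded_linear H using H by (rule has_derivative_bounded_linear)
  define K where "K = norm u * (2 * norm u + norm v) + 1"
  have K: "K > 0" by (simp add: K_def add_nonneg_pos)
  define N where "N = norm u + norm v + 1"
  have N: "N > 0" by (simp add: N_def add_nonneg_pos)
  obtain d where d: "d > 0" "\<And>y. norm (y - x) < d \<Longrightarrow> norm (G y - G x - H (y - x)) \<le> (e / K) * norm (y - x)"
    using H \<open>e > 0\<close> K unfolding has_derivative_at_alt by (metis divide_pos_pos)
  have main: "\<bar>f (x + t *\<^sub>R u + t *\<^sub>R v) - f (x + t *\<^sub>R u) - f (x + t *\<^sub>R v) + f x - t\<^sup>2 * inner u (H v)\<bar> \<le> e * t\<^sup>2"
    if t: "0 < t" "t < d / N" for t
  proof -
    define \<phi> where "\<phi> s = f (x + s *\<^sub>R u + t *\<^sub>R v) - f (x + s *\<^sub>R u)" for s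
    have F: "(f has_derivative (\<lambda>h. inner h (G z))) (at z)" for z using G unfolding gderiv_def .
    have "(\<phi> has_derivative (\<lambda>h. inner (h *\<^sub>R u) (G (x + s *\<^sub>R u + t *\<^sub>R v)) - inner (h *\<^sub>R u) (G (x + s *\<^sub>R u)))) (at s)" for s
      unfolding \<phi>_def
      by (rule has_derivative_diff; rule has_derivative_compose[OF _ F]) (auto intro!: derivative_eq_intros)
    then have der: "(\<phi> has_real_derivative (inner u (G (x + s *\<^sub>R u + t *\<^sub>R v) - G (x + s *\<^sub>R u)))) (at s)" for s
      by (rule has_derivative_imp_has_field_derivative) (simp add: inner_diff_right algebra_simps)
    obtain s where s: "0 < s" "s < t" "\<phi> t - \<phi> 0 = t * inner u (G (x + s *\<^sub>R u + t *\<^sub>R v) - G (x + s *\<^sub>R u))"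
      using MVT2[OF t(1), of \<phi> "\<lambda>s. inner u (G (x + s *\<^sub>R u + t *\<^sub>R v) - G (x + s *\<^sub>R u))"] der by auto
    define R where "R w = G (x + w) - G x - H w" for w
    have R: "norm (R w) \<le> (e / K) * norm w" if "norm w < d" for w
      using d(2)[of "x + w"] that by (simp add: R_def)
    have tN: "t * N < d" using t N by (simp add: field_simps)
    have n1: "norm (s *\<^sub>R u + t *\<^sub>R v) \<le> t * (norm u + norm v)"
    proof -
      have "norm (s *\<^sub>R u + t *\<^sub>R v) \<le> s * norm u + t * norm v"
        using norm_triangle_ineq[of "s *\<^sub>R u" "t *\<^sub>R v"] s(1) t by simp
      also have "\<dots> \<le> t * norm u + t * norm v" using s by (simp add: mult_right_mono)
      finally show ?thesis by (simp add: algebra_simps)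
    qed
    have n2: "norm (s *\<^sub>R u) \<le> t * norm u" using s by (simp add: mult_right_mono)
    have "t * (norm u + norm v) \<le> t * N" "t * norm u \<le> t * N"
      using t by (auto simp: N_def intro!: mult_left_mono)
    then have d12: "norm (s *\<^sub>R u + t *\<^sub>R v) < d" "norm (s *\<^sub>R u) < d" using n1 n2 tN by linarith+
    have "norm (R (s *\<^sub>R u + t *\<^sub>R v) - R (s *\<^sub>R u)) \<le> (e / K) * norm (s *\<^sub>R u + t *\<^sub>R v) + (e / K) * norm (s *\<^sub>R u)"
      using norm_triangle_ineq4[of "R (s *\<^sub>R u + t *\<^sub>R v)" "R (s *\<^sub>R u)"] R[OF d12(1)] R[OF d12(2)] by linarith
    also have "\<dots> \<le> (e / K) * (t * (norm u + norm v)) + (e / K) * (t * norm u)"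
      using n1 n2 K \<open>e > 0\<close> by (intro add_mono mult_left_mono) auto
    also have "\<dots> = (e / K) * t * (2 * norm u + norm v)" by (simp add: algebra_simps)
    finally have Rb: "norm (R (s *\<^sub>R u + t *\<^sub>R v) - R (s *\<^sub>R u)) \<le> (e / K) * t * (2 * norm u + norm v)" .
    have "G (x + s *\<^sub>R u + t *\<^sub>R v) - G (x + s *\<^sub>R u) = t *\<^sub>R H v + (R (s *\<^sub>R u + t *\<^sub>R v) - R (s *\<^sub>R u))"
      by (simp add: R_def H.add H.scaleR add.assoc)
    then have "\<phi> t - \<phi> 0 - t\<^sup>2 * inner u (H v) = t * inner u (R (s *\<^sub>R u + t *\<^sub>R v) - R (s *\<^sub>R u))"
      unfolding s(3) by (simp only: inner_add_right inner_scaleR_right) (simp add: power2_eq_square algebra_simps)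
    then have "\<bar>\<phi> t - \<phi> 0 - t\<^sup>2 * inner u (H v)\<bar> = t * \<bar>inner u (R (s *\<^sub>R u + t *\<^sub>R v) - R (s *\<^sub>R u))\<bar>"
      using t by (simp add: abs_mult)
    also have "\<dots> \<le> t * (norm u * ((e / K) * t * (2 * norm u + norm v)))"
      using t order_trans[OF Cauchy_Schwarz_ineq2 mult_left_mono[OF Rb norm_ge_zero]] by (intro mult_left_mono) auto
    also have "\<dots> = e * t\<^sup>2 * ((K - 1) / K)" by (simp add: K_def power2_eq_square mult_ac)
    also have "\<dots> \<le> e * t\<^sup>2 * 1" using \<open>e > 0\<close> K by (intro mult_left_mono) auto
    finally show ?thesis by (simp add: \<phi>_def algebra_simps)
  qed
  show ?thesis using main d(1) N by (intro exI[of _ "d / N"]) auto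
qed

text \<open>
  The second difference is symmetric in \<open>u\<close> and \<open>v\<close>, so both mixed derivatives are its limit after
  division by \<open>t\<^sup>2\<close>.
\<close>

lemma second_derivative_symmetric:
  fixes f :: "'a::real_inner \<Rightarrow> real"
  assumes G: "\<And>z. GDERIV f z :> G z"
    and H: "(G has_derivative H) (at x)"
  shows "inner u (H v) = inner v (H u)"
proof -
  have "\<bar>inner u (H v) - inner v (H u)\<bar> \<le> 0 + e" if "e > 0" for e
  proof -
    have e: "e / 2 > 0" using that by simp
    obtain d1 where d1: "d1 > 0" "\<And>t. 0 < t \<Longrightarrow> t < d1 \<Longrightarrow>
      \<bar>f (x + t *\<^sub>R u + t *\<^sub>R v) - f (x + t *\<^sub>R u) - f (x + t *\<^sub>R v) + f x - t\<^sup>2 * inner u (H v)\<bar> \<le> e / 2 * t\<^sup>2"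
      using second_difference[OF G H e, of u v] by blast
    obtain d2 where d2: "d2 > 0" "\<And>t. 0 < t \<Longrightarrow> t < d2 \<Longrightarrow>
      \<bar>f (x + t *\<^sub>R v + t *\<^sub>R u) - f (x + t *\<^sub>R v) - f (x + t *\<^sub>R u) + f x - t\<^sup>2 * inner v (H u)\<bar> \<le> e / 2 * t\<^sup>2"
      using second_difference[OF G H e, of v u] by blast
    define t where "t = min d1 d2 / 2"
    have t: "0 < t" "t < d1" "t < d2" using d1(1) d2(1) by (auto simp: t_def min_def)
    have sw: "x + t *\<^sub>R v + t *\<^sub>R u = x + t *\<^sub>R u + t *\<^sub>R v" by simp
    have "\<bar>a - c\<bar> \<le> e * t\<^sup>2" if "\<bar>F - F1 - F2 + F0 - a\<bar> \<le> e / 2 * t\<^sup>2" "\<bar>F - F2 - F1 + F0 - c\<bar> \<le> e / 2 * t\<^sup>2"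
      for a c F F0 F1 F2 :: real
    proof -
      have "e / 2 * t\<^sup>2 + e / 2 * t\<^sup>2 = e * t\<^sup>2" by simp
      then show ?thesis using that by (simp only: abs_le_iff) linarith
    qed
    from this[OF d1(2)[OF t(1,2)] d2(2)[OF t(1,3), unfolded sw]]
    have "\<bar>t\<^sup>2 * inner u (H v) - t\<^sup>2 * inner v (H u)\<bar> \<le> e * t\<^sup>2" .
    then have "t\<^sup>2 * \<bar>inner u (H v) - inner v (H u)\<bar> \<le> t\<^sup>2 * e"
      unfolding right_diff_distrib[symmetric] abs_mult by (simp add: mult.commute)
    then show ?thesis using t by simp
  qed
  then have "\<bar>inner u (H v) - inner v (H u)\<bar> \<le> 0" by (rule field_le_epsilon)
  then show ?thesis by simp
qed

lemma has_derivative_directional_quotient: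
  assumes "(G has_derivative H) (at x)"
  shows "((\<lambda>t::real. (1 / t) *\<^sub>R (G (x + t *\<^sub>R v) - G x)) \<longlongrightarrow> H v) (at_right 0)"
proof -
  have "((\<lambda>t. G (x + t *\<^sub>R v)) has_derivative (\<lambda>h. H (h *\<^sub>R v))) (at 0)"
    by (rule has_derivative_compose[where g = G])
      (use assms in \<open>auto intro!: derivative_eq_intros\<close>)
  then have "((\<lambda>t. norm (G (x + t *\<^sub>R v) - G x - H (t *\<^sub>R v)) / norm t) \<longlongrightarrow> 0) (at (0::real))"
    by (simp add: has_derivative_at)
  then have lim: "((\<lambda>t. norm (G (x + t *\<^sub>R v) - G x - H (t *\<^sub>R v)) / norm t) \<longlongrightarrow> 0) (at_right (0::real))"
    by (rule filterlim_mono[OF _ order_refl at_le]) simp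
  have *: "norm (G (x + t *\<^sub>R v) - G x - H (t *\<^sub>R v)) / norm t
      = norm ((1 / t) *\<^sub>R (G (x + t *\<^sub>R v) - G x) - H v)" if "t > 0" for t :: real
  proof -
    have "(1 / t) *\<^sub>R (G (x + t *\<^sub>R v) - G x) - H v = (1 / t) *\<^sub>R (G (x + t *\<^sub>R v) - G x - H (t *\<^sub>R v))"
      using that has_derivative_bounded_linear[OF assms]
      by (simp add: linear_simps scaleR_diff_right)
    then show ?thesis using that by simp
  qed
  have ev: "eventually (\<lambda>t. norm (G (x + t *\<^sub>R v) - G x - H (t *\<^sub>R v)) / norm t
      = norm ((1 / t) *\<^sub>R (G (x + t *\<^sub>R v) - G x) - H v)) (at_right (0::real))"
    using eventually_at_right_less[of "0::real"] by (rule eventually_mono) (rule *)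
  have "((\<lambda>t. norm ((1 / t) *\<^sub>R (G (x + t *\<^sub>R v) - G x) - H v)) \<longlongrightarrow> 0) (at_right (0::real))"
    by (rule Lim_transform_eventually[OF lim ev])
  then show ?thesis by (simp add: tendsto_norm_zero_iff LIM_zero_iff)
qed

lemma convex_gradient_inequality:
  fixes f :: "'a::real_inner \<Rightarrow> real"
  assumes cv: "convex_on UNIV f" and G: "GDERIV f x :> D"
  shows "f x + inner (y - x) D \<le> f y"
proof -
  have "((\<lambda>t. (1 / t) *\<^sub>R (f (x + t *\<^sub>R (y - x)) - f x)) \<longlongrightarrow> inner (y - x) D) (at_right 0)"
    using G unfolding gderiv_def by (rule has_derivative_directional_quotient)
  moreover have "eventually (\<lambda>t. (1 / t) *\<^sub>R (f (x + t *\<^sub>R (y - x)) - f x) \<le> f y - f x) (at_right 0)"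
    unfolding eventually_at_right_field
  proof (intro exI[of _ "1::real"] conjI allI impI)
    fix t :: real assume t: "0 < t" "t < 1"
    have "f ((1 - t) *\<^sub>R x + t *\<^sub>R y) \<le> (1 - t) * f x + t * f y"
      using convex_onD[OF cv, of t x y] t by simp
    moreover have "(1 - t) *\<^sub>R x + t *\<^sub>R y = x + t *\<^sub>R (y - x)" by (simp add: algebra_simps)
    ultimately show "(1 / t) *\<^sub>R (f (x + t *\<^sub>R (y - x)) - f x) \<le> f y - f x"
      using t by (simp add: field_simps)
  qed auto
  ultimately have "inner (y - x) D \<le> f y - f x"
    by (intro tendsto_upperbound[where F = "at_right 0"]) auto
  then show ?thesis by simp
qed

text \<open>
  Two gradient inequalities for the convex function \<open>f - \<mu>/2 |x|\<^sup>2\<close> make \<open>G\<close> strongly monotone; the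
  claim is the limit of this along \<open>x + t v\<close>.
\<close>

lemma strongly_convex_hessian_lower:
  fixes f :: "'a::real_inner \<Rightarrow> real"
  assumes G: "\<And>z. GDERIV f z :> G z"
    and cv: "convex_on UNIV (\<lambda>x. f x - \<mu> / 2 * (norm x)\<^sup>2)"
    and H: "(G has_derivative H) (at x)"
  shows "\<mu> * (norm v)\<^sup>2 \<le> inner v (H v)"
proof -
  have G': "GDERIV (\<lambda>x. f x - \<mu> / 2 * (norm x)\<^sup>2) z :> G z - \<mu> *\<^sub>R z" for z
    using G[of z] unfolding gderiv_def power2_norm_eq_inner
    by (auto intro!: derivative_eq_intros simp: inner_diff_right inner_commute algebra_simps)
  have mono: "\<mu> * (norm (b - a))\<^sup>2 \<le> inner (b - a) (G b - G a)" for a b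
    using convex_gradient_inequality[OF cv G', of a b] convex_gradient_inequality[OF cv G', of b a]
    unfolding power2_norm_eq_inner
    by (simp add: inner_diff_left inner_diff_right inner_commute algebra_simps)
  have "((\<lambda>t. inner v ((1 / t) *\<^sub>R (G (x + t *\<^sub>R v) - G x))) \<longlongrightarrow> inner v (H v)) (at_right 0)"
    by (intro tendsto_intros has_derivative_directional_quotient H)
  moreover have "eventually (\<lambda>t. \<mu> * (norm v)\<^sup>2 \<le> inner v ((1 / t) *\<^sub>R (G (x + t *\<^sub>R v) - G x))) (at_right 0)"
    unfolding eventually_at_right_field
  proof (intro exI[of _ "1::real"] conjI allI impI)
    fix t :: real assume t: "0 < t"
    show "\<mu> * (norm v)\<^sup>2 \<le> inner v ((1 / t) *\<^sub>R (G (x + t *\<^sub>R v) - G x))"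
      using mono[of "x + t *\<^sub>R v" x] t
      unfolding inner_scaleR_right by (simp add: power_mult_distrib power2_eq_square field_simps)
  qed auto
  ultimately show ?thesis
    by (intro tendsto_lowerbound[where F = "at_right 0"]) auto
qed

lemma lipschitz_derivative_bound:
  assumes lip: "L-lipschitz_on UNIV G" and H: "(G has_derivative H) (at x)"
  shows "norm (H v) \<le> L * norm v"
proof -
  have "((\<lambda>t. norm ((1 / t) *\<^sub>R (G (x + t *\<^sub>R v) - G x))) \<longlongrightarrow> norm (H v)) (at_right 0)"
    by (intro tendsto_intros has_derivative_directional_quotient H)
  moreover have "eventually (\<lambda>t. norm ((1 / t) *\<^sub>R (G (x + t *\<^sub>R v) - G x)) \<le> L * norm v) (at_right 0)"
    unfolding eventually_at_right_field
  proof (intro exI[of _ "1::real"] conjI allI impI)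
    fix t :: real assume t: "0 < t"
    show "norm ((1 / t) *\<^sub>R (G (x + t *\<^sub>R v) - G x)) \<le> L * norm v"
      using lipschitz_onD[OF lip, of "x + t *\<^sub>R v" x] t
      unfolding norm_scaleR dist_norm by (simp add: field_simps)
  qed auto
  ultimately show ?thesis
    by (intro tendsto_upperbound[where F = "at_right 0"]) auto
qed

section \<open>The resolvent of a gradient and its Jacobian\<close>

lemma grad_eqI: "GDERIV f x :> D \<Longrightarrow> grad f x = D"
proof -
  assume D: "GDERIV f x :> D"
  have "E = D" if "GDERIV f x :> E" for E
  proof -
    have "(\<lambda>h. inner h E) = (\<lambda>h. inner h D)"
      using that D unfolding gderiv_def by (rule has_derivative_unique)
    then have "inner (E - D) E = inner (E - D) D" by (rule fun_cong)
    then have "inner (E - D) (E - D) = 0" by (simp add: inner_diff_right)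
    then show ?thesis by simp
  qed
  with D show ?thesis unfolding grad_def by (rule the_equality)
qed

lemma GDERIV_grad:
  fixes f :: "'a::euclidean_space \<Rightarrow> real"
  assumes "f differentiable (at x)"
  shows "GDERIV f x :> grad f x"
proof -
  obtain f' where f': "(f has_derivative f') (at x)" using assms unfolding differentiable_def by blast
  have "f' = (\<lambda>h. inner h (adjoint f' 1))"
    using adjoint_works[OF has_derivative_linear[OF f']] by fastforce
  then have D: "GDERIV f x :> adjoint f' 1" using f' unfolding gderiv_def by metis
  then show ?thesis by (simp add: grad_eqI)
qed

lemma proper_closed_convex_real:
  fixes f :: "'a::real_normed_vector \<Rightarrow> real"
  assumes "convex_on UNIV f" "continuous_on UNIV f"
  shows "proper_closed_convex (\<lambda>z. ereal (f z))"
proof -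
  have "epi (\<lambda>z. ereal (f z)) = epigraph UNIV f" by (auto simp: epi_def epigraph_def)
  then have "convex (epi (\<lambda>z. ereal (f z)))" using assms(1) by (simp add: convex_epigraph)
  moreover have "epi (\<lambda>z. ereal (f z)) = {y. f (fst y) \<le> snd y}" by (auto simp: epi_def)
  moreover have "closed {y. f (fst y) \<le> snd y}"
    by (intro closed_Collect_le continuous_intros continuous_on_compose2[OF assms(2)]) auto
  ultimately show ?thesis unfolding proper_closed_convex_def by auto
qed

lemma prox_resolvent_equation:
  fixes f :: "'a::euclidean_space \<Rightarrow> real"
  assumes cv: "proper_closed_convex (\<lambda>z. ereal (f z))" and "\<gamma> > 0"
    and G: "\<And>z. GDERIV f z :> G z"
  shows "prox \<gamma> (\<lambda>z. ereal (f z)) x + \<gamma> *\<^sub>R G (prox \<gamma> (\<lambda>z. ereal (f z)) x) = x"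
proof -
  define p where "p = prox \<gamma> (\<lambda>z. ereal (f z)) x"
  define \<psi> where "\<psi> z = f z - inner (x - p) z / \<gamma>" for z
  have "\<psi> p \<le> \<psi> z" for z
    using prox_variational[OF cv \<open>\<gamma> > 0\<close>, of z "f z" x]
    unfolding \<psi>_def p_def[symmetric] inner_diff_right diff_divide_distrib by simp
  moreover have "(\<psi> has_derivative (\<lambda>h. inner h (G p) - inner (x - p) h / \<gamma>)) (at p)"
    using G[of p] \<open>\<gamma> > 0\<close> unfolding gderiv_def \<psi>_def by (auto intro!: derivative_eq_intros)
  ultimately have "(\<lambda>h. inner h (G p) - inner (x - p) h / \<gamma>) = (\<lambda>h. 0)"
    by (intro has_derivative_local_min) auto
  then have "inner h (\<gamma> *\<^sub>R G p - (x - p)) = 0" for h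
    using \<open>\<gamma> > 0\<close> by (auto simp: fun_eq_iff inner_diff_right inner_diff_left inner_add_right inner_commute field_simps)
  then have "\<gamma> *\<^sub>R G p - (x - p) = 0" using inner_eq_zero_iff by blast
  then show ?thesis unfolding p_def[symmetric] by (simp add: algebra_simps)
qed

text \<open>
  This gives both invertibility of \<open>I + \<gamma> M\<close> and a bound on its inverse that is uniform in \<open>M\<close>.
\<close>

lemma identity_plus_monotone_expansive:
  fixes M :: "real^'n^'n"
  assumes "\<And>v. inner v (M *v v) \<ge> 0" "\<gamma> > 0"
  shows "norm v \<le> norm ((mat 1 + \<gamma> *\<^sub>R M) *v v)"
proof (cases "v = 0")
  case False
  have "norm v * norm v \<le> inner v v + \<gamma> * inner v (M *v v)"
    using assms by (simp add: power2_norm_eq_inner[symmetric] power2_eq_square)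
  also have "\<dots> = inner v ((mat 1 + \<gamma> *\<^sub>R M) *v v)"
    by (simp add: matrix_vector_mult_add_rdistrib scaleR_matrix_vector_assoc[symmetric] inner_add_right)
  also have "\<dots> \<le> norm v * norm ((mat 1 + \<gamma> *\<^sub>R M) *v v)" by (rule norm_cauchy_schwarz)
  finally show ?thesis using False by simp
qed simp

text \<open>
  \<open>prox\<close> is a continuous right inverse of \<open>p + \<gamma> G p\<close>, so it is differentiable wherever that map has
  an invertible derivative.
\<close>

lemma prox_has_derivative:
  fixes f :: "real^'n \<Rightarrow> real"
  assumes cv: "proper_closed_convex (\<lambda>z. ereal (f z))" and "\<gamma> > 0"
    and G: "\<And>z. GDERIV f z :> G z"
    and M: "(G has_derivative (\<lambda>h. M *v h)) (at (prox \<gamma> (\<lambda>z. ereal (f z)) x))"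
    and B: "B ** (mat 1 + \<gamma> *\<^sub>R M) = mat 1"
  shows "(prox \<gamma> (\<lambda>z. ereal (f z)) has_derivative (\<lambda>h. B *v h)) (at x)"
proof (rule has_derivative_inverse_basic[where T = UNIV])
  show "((\<lambda>p. p + \<gamma> *\<^sub>R G p) has_derivative (\<lambda>h. (mat 1 + \<gamma> *\<^sub>R M) *v h)) (at (prox \<gamma> (\<lambda>z. ereal (f z)) x))"
    by (auto intro!: derivative_eq_intros M
        simp: matrix_vector_mult_add_rdistrib scaleR_matrix_vector_assoc)
  show "(*v) B \<circ> (*v) (mat 1 + \<gamma> *\<^sub>R M) = id"
    using B by (auto simp: fun_eq_iff matrix_vector_mul_assoc)
  show "continuous (at x) (prox \<gamma> (\<lambda>z. ereal (f z)))"
    using continuous_on_prox[OF cv \<open>\<gamma> > 0\<close>] by (simp add: continuous_on_eq_continuous_at)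
qed (use prox_resolvent_equation[OF cv \<open>\<gamma> > 0\<close> G] in auto)

text \<open>
  Continuity of \<open>x \<mapsto> A(x)\<^sup>-\<^sup>1 b(x)\<close> without differentiating or computing inverses: since \<open>A\<close> is
  expansive, the residual of the fixed vector \<open>w y\<close> in the system at \<open>x\<close> bounds its error.
\<close>

lemma continuous_on_linear_solution:
  fixes A :: "'a::topological_space \<Rightarrow> real^'n^'n"
  assumes A: "continuous_on UNIV A" and b: "continuous_on UNIV b"
    and sol: "\<And>x. A x *v w x = b x" and exp: "\<And>x v. norm v \<le> norm (A x *v v)"
  shows "continuous_on UNIV w"
proof -
  have "(w \<longlongrightarrow> w y) (at y)" for y
  proof (rule Lim_null[THEN iffD2], rule Lim_null_comparison)
    show "\<forall>\<^sub>F x in at y. norm (w x - w y) \<le> norm (b x - A x *v w y)"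
    proof (rule always_eventually, rule allI)
      show "norm (w x - w y) \<le> norm (b x - A x *v w y)" for x
        using exp[of "w x - w y" x] by (simp add: matrix_vector_mult_diff_distrib sol)
    qed
    have "continuous_on UNIV (\<lambda>x. norm (b x - A x *v w y))"
      unfolding matrix_vector_mult_def by (intro continuous_intros A b)
    then have "((\<lambda>x. norm (b x - A x *v w y)) \<longlongrightarrow> norm (b y - A y *v w y)) (at y)"
      by (simp add: continuous_on_def)
    then show "((\<lambda>x. norm (b x - A x *v w y)) \<longlongrightarrow> 0) (at y)" by (simp add: sol)
  qed
  then show ?thesis by (simp add: continuous_on_def)
qed

text \<open>
  With \<open>J = (I + \<gamma> M)\<^sup>-\<^sup>1\<close>, a kernel vector \<open>v\<close> of \<open>2 J - I\<close> is twice \<open>w = J v\<close>, and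
  \<open>2 w = (I + \<gamma> M) w\<close> makes \<open>w\<close> an eigenvector of \<open>\<gamma> M\<close> for the eigenvalue \<open>1\<close>.
\<close>

lemma reflected_inverse_invertible:
  fixes M :: "real^'n^'n"
  assumes inv: "(mat 1 + \<gamma> *\<^sub>R M) ** J = mat 1"
    and ker: "\<And>w. \<gamma> *\<^sub>R (M *v w) = w \<Longrightarrow> w = 0"
  shows "invertible (2 *\<^sub>R J - mat 1)"
proof -
  have "v = 0" if "(2 *\<^sub>R J - mat 1) *v v = 0" for v
  proof -
    define w where "w = J *v v"
    have v: "v = 2 *\<^sub>R w"
      using that by (simp add: w_def matrix_vector_mult_diff_rdistrib scaleR_matrix_vector_assoc)
    have "v = (mat 1 + \<gamma> *\<^sub>R M) *v w"
      unfolding w_def by (simp add: matrix_vector_mul_assoc inv)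
    then have "\<gamma> *\<^sub>R (M *v w) = w"
      unfolding v by (simp add: matrix_vector_mult_add_rdistrib scaleR_matrix_vector_assoc[symmetric] scaleR_2)
    then show ?thesis using ker v by simp
  qed
  then show ?thesis
    by (simp add: invertible_left_inverse matrix_left_invertible_ker)
qed

section \<open>The Douglas-Rachford envelope\<close>

theorem mainTheorem1:
  fixes f :: "real^'n \<Rightarrow> real"
    and g :: "real^'n \<Rightarrow> ereal"
    and L\<^sub>f \<mu>\<^sub>f \<gamma> :: real
  assumes "convex_on UNIV f"
    and "C2_fun f"
    and "L\<^sub>f-lipschitz_on UNIV (grad f)"
    and "\<mu>\<^sub>f \<ge> 0"
    and "convex_on UNIV (\<lambda>x. f x - \<mu>\<^sub>f / 2 * (norm x)\<^sup>2)"
    and "proper_closed_convex g"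
    and "{x. is_arg_min (\<lambda>w. ereal (f w) + g w) (\<lambda>_. True) x} \<noteq> {}"
    and "(0 < \<gamma> \<and> (L\<^sub>f = 0 \<or> \<gamma> < 1 / L\<^sub>f)) \<or> (\<mu>\<^sub>f > 0 \<and> \<gamma> > 1 / \<mu>\<^sub>f)"
  shows "(\<forall>x. \<bar>DR_env \<gamma> f g x\<bar> \<noteq> \<infinity>) \<and>
    (\<forall>x. DR_P \<gamma> f differentiable (at x)) \<and>
    C1_fun (DR_env_real \<gamma> f g) \<and>
    (\<forall>x. grad (DR_env_real \<gamma> f g) x =
        inverse \<gamma> *\<^sub>R (reflected_jacobian \<gamma> f x *v DR_Z \<gamma> f g x)) \<and>
    (\<forall>x. invertible (reflected_jacobian \<gamma> f x)) \<and>
    {x. grad (DR_env_real \<gamma> f g) x = 0} = {x. DR_Z \<gamma> f g x = 0} \<and>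
    (\<forall>lam x y z. DR_splitting \<gamma> f g lam x y z \<longrightarrow>
      (\<forall>k. x (Suc k) = x k - lam k *\<^sub>R
        ((\<gamma> *\<^sub>R matrix_inv (reflected_jacobian \<gamma> f (x k))) *v grad (DR_env_real \<gamma> f g) (x k))))"
proof -
  define G where "G = grad f"
  define M where "M z = jacobian (grad f) (at z)" for z
  define P where "P = DR_P \<gamma> f"
  define J where "J x = jacobian P (at x)" for x
  define A where "A x = mat 1 + \<gamma> *\<^sub>R M (P x)" for x
  define Z where "Z = DR_Z \<gamma> f g"
  define R where "R x = 2 *\<^sub>R J x - mat 1" for x
  have R: "reflected_jacobian \<gamma> f = R" by (simp add: fun_eq_iff R_def J_def P_def reflected_jacobian_def)
  have \<gamma>: "\<gamma> > 0" using assms(8)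
    by (metis less_trans zero_less_divide_1_iff)
  have G: "GDERIV f z :> G z" for z
    using assms(2) unfolding G_def C2_fun_def by (blast intro: GDERIV_grad)
  have M: "(G has_derivative (\<lambda>h. M z *v h)) (at z)" for z
    using assms(2) unfolding G_def M_def C2_fun_def by (simp flip: jacobian_works)
  have contM: "continuous_on UNIV M" using assms(2) unfolding C2_fun_def M_def by simp
  have Msym: "inner u (M z *v v) = inner v (M z *v u)" for u v z
    using second_derivative_symmetric[OF G M] .
  have Mlow: "\<mu>\<^sub>f * (norm v)\<^sup>2 \<le> inner v (M z *v v)" for v z
    using strongly_convex_hessian_lower[OF G assms(5) M] .
  have Mpos: "0 \<le> inner v (M z *v v)" for v z
    using order_trans[OF _ Mlow] assms(4) by simp
  have Mup: "norm (M z *v v) \<le> L\<^sub>f * norm v" for v z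
    using lipschitz_derivative_bound[OF _ M] assms(3) by (simp add: G_def)
  have contf: "continuous_on UNIV f"
    using G unfolding gderiv_def by (meson continuous_at_imp_continuous_on has_derivative_continuous)
  have pf: "proper_closed_convex (\<lambda>z. ereal (f z))"
    by (rule proper_closed_convex_real[OF assms(1) contf])
  have P_eq: "P = prox \<gamma> (\<lambda>z. ereal (f z))" by (simp add: fun_eq_iff P_def DR_P_def)
  have contP: "continuous_on UNIV P" unfolding P_eq by (rule continuous_on_prox[OF pf \<gamma>])
  have Aexp: "norm v \<le> norm (A x *v v)" for x v
    unfolding A_def by (rule identity_plus_monotone_expansive[OF Mpos \<gamma>])
  have derP: "(P has_derivative (\<lambda>h. J x *v h)) (at x)" and JA: "J x ** A x = mat 1" for x
  proof -
    have "v = 0" if "A x *v v = 0" for v using Aexp[of v x] that by simp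
    then obtain B where B: "B ** A x = mat 1" using matrix_left_invertible_ker by blast
    have D: "(P has_derivative (\<lambda>h. B *v h)) (at x)"
      unfolding P_eq by (rule prox_has_derivative[OF pf \<gamma> G M[of "P x", unfolded P_eq]])
        (use B in \<open>simp add: A_def P_eq\<close>)
    then have "J x = B" unfolding J_def jacobian_def
      by (simp add: frechet_derivative_at[symmetric] matrix_of_matrix_vector_mul)
    with B D show "(P has_derivative (\<lambda>h. J x *v h)) (at x)" "J x ** A x = mat 1" by auto
  qed
  have AJ: "A x ** J x = mat 1" for x using JA matrix_left_right_inverse by blast
  \<comment> \<open>Symmetry passes from \<open>A\<close> to its inverse.\<close>
  have Jsym: "inner u (J x *v v) = inner v (J x *v u)" for u v x
  proof -
    have A: "inner a (A x *v b) = inner b (A x *v a)" for a b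
      using Msym[of a "P x" b]
      by (simp add: A_def matrix_vector_mult_add_rdistrib scaleR_matrix_vector_assoc[symmetric] inner_add_right inner_commute)
    have *: "A x *v (J x *v w) = w" for w by (simp add: matrix_vector_mul_assoc AJ)
    show ?thesis using A[of "J x *v u" "J x *v v"] by (simp add: * inner_commute)
  qed
  have Rv: "R x *v v = 2 *\<^sub>R (J x *v v) - v" for x v
    by (simp add: R_def matrix_vector_mult_diff_rdistrib scaleR_matrix_vector_assoc)
  have Rinv: "invertible (R x)" for x
    unfolding R_def
  proof (rule reflected_inverse_invertible[OF AJ[unfolded A_def]])
    fix w assume w: "\<gamma> *\<^sub>R (M (P x) *v w) = w"
    show "w = 0"
    proof (rule ccontr)
      assume "w \<noteq> 0"
      from assms(8) show False
      proof
        assume *: "0 < \<gamma> \<and> (L\<^sub>f = 0 \<or> \<gamma> < 1 / L\<^sub>f)"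
        have "L\<^sub>f \<ge> 0" using assms(3) by (rule lipschitz_on_nonneg)
        then have "\<gamma> * L\<^sub>f < 1" using * by (cases "L\<^sub>f = 0") (auto simp: field_simps)
        then have "\<gamma> * L\<^sub>f * norm w < norm w" using \<open>w \<noteq> 0\<close> by simp
        moreover have "norm w = \<gamma> * norm (M (P x) *v w)"
          using arg_cong[OF w, of norm] \<gamma> by simp
        moreover have "\<gamma> * norm (M (P x) *v w) \<le> \<gamma> * (L\<^sub>f * norm w)"
          using Mup \<gamma> by (intro mult_left_mono) auto
        ultimately show False by simp
      next
        assume *: "\<mu>\<^sub>f > 0 \<and> \<gamma> > 1 / \<mu>\<^sub>f"
        then have "\<gamma> * \<mu>\<^sub>f > 1" by (auto simp: field_simps)
        then have "(norm w)\<^sup>2 < \<gamma> * \<mu>\<^sub>f * (norm w)\<^sup>2" using \<open>w \<noteq> 0\<close> by simp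
        also have "\<dots> \<le> inner w (\<gamma> *\<^sub>R (M (P x) *v w))"
          using mult_left_mono[OF Mlow[of w "P x"], of \<gamma>] \<gamma> by simp
        also have "\<dots> = (norm w)\<^sup>2" by (simp add: w power2_norm_eq_inner)
        finally show False by simp
      qed
    qed
  qed
  define Q where "Q = prox \<gamma> g"
  define ef where "ef w = real_of_ereal (moreau_env \<gamma> (\<lambda>z. ereal (f z)) w)" for w
  define eg where "eg w = real_of_ereal (moreau_env \<gamma> g w)" for w
  have ef: "moreau_env \<gamma> (\<lambda>z. ereal (f z)) w = ereal (ef w)" for w
    unfolding ef_def by (simp add: moreau_env_eq[OF pf \<gamma>])
  have eg: "moreau_env \<gamma> g w = ereal (eg w)" for w
    unfolding eg_def by (simp add: moreau_env_eq[OF assms(6) \<gamma>])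
  have der_ef: "GDERIV ef x :> (1 / \<gamma>) *\<^sub>R (x - P x)" for x
    unfolding ef_def P_eq by (rule moreau_env_gradient[OF pf \<gamma>])
  have der_eg: "GDERIV eg x :> (1 / \<gamma>) *\<^sub>R (x - Q x)" for x
    unfolding eg_def Q_def by (rule moreau_env_gradient[OF assms(6) \<gamma>])
  have gradef: "grad ef x = (1 / \<gamma>) *\<^sub>R (x - P x)" for x by (rule grad_eqI[OF der_ef])
  define F where "F x = ef x - inner (x - P x) (x - P x) / \<gamma> + eg (2 *\<^sub>R P x - x)" for x
  have env: "DR_env \<gamma> f g x = ereal (F x)" for x
  proof -
    have reflect: "x - (2 * \<gamma>) *\<^sub>R (1 / \<gamma>) *\<^sub>R (x - P x) = 2 *\<^sub>R P x - x"
      using \<gamma> by (simp add: algebra_simps scaleR_2)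
    have sq: "\<gamma> * (norm ((1 / \<gamma>) *\<^sub>R (x - P x)))\<^sup>2 = inner (x - P x) (x - P x) / \<gamma>"
      unfolding dot_square_norm norm_scaleR power_mult_distrib
      using \<gamma> by (simp add: power2_eq_square)
    show ?thesis
      unfolding DR_env_def Let_def ef eg real_of_ereal.simps gradef reflect sq F_def by simp
  qed
  have env_real: "DR_env_real \<gamma> f g = F" by (simp add: fun_eq_iff DR_env_real_def env)
  have Z: "Z x = P x - Q (2 *\<^sub>R P x - x)" for x
    by (simp add: Z_def DR_Z_def DR_G_def P_def Q_def)
  \<comment> \<open>The chain rule, with symmetry of \<open>J\<close> moving \<open>2 J - I\<close> from \<open>h\<close> to \<open>Z x\<close>.\<close>
  have derF: "GDERIV F x :> inverse \<gamma> *\<^sub>R (R x *v Z x)" for x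
  proof -
    have d1: "(ef has_derivative (\<lambda>h. inner h ((1 / \<gamma>) *\<^sub>R (x - P x)))) (at x)"
      using der_ef unfolding gderiv_def .
    have d2: "((\<lambda>x. 2 *\<^sub>R P x - x) has_derivative (\<lambda>h. 2 *\<^sub>R (J x *v h) - h)) (at x)"
      by (auto intro!: derivative_eq_intros derP)
    have d3: "((\<lambda>x. eg (2 *\<^sub>R P x - x)) has_derivative
        (\<lambda>h. inner (2 *\<^sub>R (J x *v h) - h) ((1 / \<gamma>) *\<^sub>R (2 *\<^sub>R P x - x - Q (2 *\<^sub>R P x - x))))) (at x)"
      by (rule has_derivative_compose[OF d2]) (use der_eg in \<open>simp add: gderiv_def\<close>)
    have d4: "((\<lambda>x. x - P x) has_derivative (\<lambda>h. h - J x *v h)) (at x)"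
      by (auto intro!: derivative_eq_intros derP)
    have "(F has_derivative (\<lambda>h. inner h ((1 / \<gamma>) *\<^sub>R (x - P x))
        - (inner (x - P x) (h - J x *v h) + inner (h - J x *v h) (x - P x)) / \<gamma>
        + inner (2 *\<^sub>R (J x *v h) - h) ((1 / \<gamma>) *\<^sub>R (2 *\<^sub>R P x - x - Q (2 *\<^sub>R P x - x))))) (at x)"
      unfolding F_def
      by (rule has_derivative_add[OF has_derivative_diff[OF d1
          bounded_linear.has_derivative[OF bounded_linear_divide has_derivative_inner[OF d4 d4]]] d3])
    moreover have "inner h ((1 / \<gamma>) *\<^sub>R (x - P x))
        - (inner (x - P x) (h - J x *v h) + inner (h - J x *v h) (x - P x)) / \<gamma>
        + inner (2 *\<^sub>R (J x *v h) - h) ((1 / \<gamma>) *\<^sub>R (2 *\<^sub>R P x - x - Q (2 *\<^sub>R P x - x)))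
        = inner h (inverse \<gamma> *\<^sub>R (R x *v Z x))" for h
    proof -
      define a where "a = x - P x"
      define j where "j = J x *v h"
      have q: "2 *\<^sub>R P x - x - Q (2 *\<^sub>R P x - x) = Z x - a" by (simp add: Z a_def algebra_simps scaleR_2)
      have "inner h ((1 / \<gamma>) *\<^sub>R a) - (inner a (h - j) + inner (h - j) a) / \<gamma>
          + inner (2 *\<^sub>R j - h) ((1 / \<gamma>) *\<^sub>R (Z x - a))
          = (inner h a - (inner a (h - j) + inner (h - j) a) + inner (2 *\<^sub>R j - h) (Z x - a)) / \<gamma>"
        by (simp add: add_divide_distrib diff_divide_distrib)
      also have "inner h a - (inner a (h - j) + inner (h - j) a) + inner (2 *\<^sub>R j - h) (Z x - a)
          = 2 * inner (Z x) j - inner h (Z x)"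
        by (simp add: inner_diff_left inner_diff_right inner_commute)
      also have "\<dots> = inner h (R x *v Z x)"
        unfolding j_def Jsym[of "Z x" x h] by (simp add: Rv inner_diff_right)
      finally show ?thesis unfolding q a_def[symmetric] j_def[symmetric] by (simp add: divide_inverse mult.commute)
    qed
    ultimately show ?thesis unfolding gderiv_def by simp
  qed
  have gradF: "grad F x = inverse \<gamma> *\<^sub>R (R x *v Z x)" for x by (rule grad_eqI[OF derF])
  have contZ: "continuous_on UNIV Z"
  proof -
    have "Z = (\<lambda>x. P x - Q (2 *\<^sub>R P x - x))" by (simp add: fun_eq_iff Z)
    moreover have "continuous_on UNIV \<dots>"
      unfolding Q_def
      by (intro continuous_intros contP continuous_on_compose2[OF continuous_on_prox[OF assms(6) \<gamma>]]) auto
    ultimately show ?thesis by simp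
  qed
  have contA: "continuous_on UNIV A"
    unfolding A_def by (intro continuous_intros continuous_on_compose2[OF contM contP]) auto
  have "continuous_on UNIV (\<lambda>x. J x *v Z x)"
    by (rule continuous_on_linear_solution[OF contA contZ _ Aexp]) (simp add: matrix_vector_mul_assoc AJ)
  then have contgrad: "continuous_on UNIV (grad F)"
    unfolding gradF[abs_def] Rv by (intro continuous_intros contZ)
  have C1: "C1_fun F"
    unfolding C1_fun_def using contgrad derF unfolding gderiv_def differentiable_def by blast
  have inv: "matrix_inv (R x) *v (R x *v v) = v" for x v
  proof -
    have "R x ** matrix_inv (R x) = mat 1 \<and> matrix_inv (R x) ** R x = mat 1"
      using Rinv[of x] unfolding invertible_def matrix_inv_def by (rule someI_ex)
    then show ?thesis by (simp add: matrix_vector_mul_assoc)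
  qed
  have stat: "grad F x = 0 \<longleftrightarrow> Z x = 0" for x
    using inv[of x "Z x"] \<gamma> by (auto simp: gradF)
  have step: "x (Suc k) = x k - lam k *\<^sub>R ((\<gamma> *\<^sub>R matrix_inv (R (x k))) *v grad F (x k))"
    if "DR_splitting \<gamma> f g lam x y z" for lam x y z k
  proof -
    have "y k = P (x k)" "z k = Q (2 *\<^sub>R y k - x k)" "x (Suc k) = x k + lam k *\<^sub>R (z k - y k)"
      using that by (auto simp: DR_splitting_def P_eq Q_def)
    then have "x (Suc k) = x k - lam k *\<^sub>R Z (x k)" by (simp add: Z algebra_simps)
    moreover have "(\<gamma> *\<^sub>R matrix_inv (R (x k))) *v grad F (x k) = Z (x k)"
      using \<gamma> by (simp add: gradF scaleR_matrix_vector_assoc[symmetric] matrix_vector_mult_scaleR inv)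
    ultimately show ?thesis by simp
  qed
  have "P differentiable (at x)" for x using derP unfolding differentiable_def by blast
  then show ?thesis
    unfolding R env_real P_def[symmetric] Z_def[symmetric]
    using env C1 gradF Rinv stat step by simp
qed

end
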